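(* Let $E$ be a finite-dimensional vector space over $\mathbb F_q$, let $M=(\mathbb PE,r)$ be a matroid with lattice of flats $\mathcal F_M$, and for $F\subseteq\mathbb PE$ let $P^{-1}(F)\cup\{0\}=\{0\}\cup\bigcup_{\ell\in F}\ell\subseteq E$. If $P^{-1}(F)\cup\{0\}$ is a subspace of $E$ for every $F\in\mathcal F_M$, then the collection $\{P^{-1}(F)\cup\{0\}:F\in\mathcal F_M\}$ is the collection of flats of a (unique) $q$-matroid $\mathcal M$ with groundspace $E$, and $\mathcal F_M\cong\mathcal F_{\mathcal M}$ as lattices.
   Context: $\mathbb PE$ denotes the set of $1$-dimensional subspaces of $E$. A $q$-matroid is a pair $(E,\rho)$ where $\rho$ assigns to each subspace of $E$ a nonnegative integer such that $0\le\rho(V)\le\dim V$, $V\le W\Rightarrow\rho(V)\le\rho(W)$, and $\rho(V+W)+\rho(V\cap W)\le\rho(V)+\rho(W)$. A flat of a $q$-matroid is a subspace $F$ with $\rho(F+\langle v\rangle)>\rho(F)$ for all $v\notin F$; the flats of a $q$-matroid determine it and form a lattice $\mathcal F_{\mathcal M}$ under inclusion (meet is intersection, join is closure of the sum). Flats of a matroid are the usual ones and form the lattice $\mathcal F_M$. *)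

theory Defs
  imports Complex_Main "HOL-Library.Set_Algebras" "HOL-Algebra.Lattice"
begin

locale matroid =
  fixes S :: "'a set" and r :: "'a set \<Rightarrow> nat"
  assumes finite_ground: "finite S"
    and rank_le_card: "X \<subseteq> S \<Longrightarrow> r X \<le> card X"
    and rank_mono: "X \<subseteq> Y \<Longrightarrow> Y \<subseteq> S \<Longrightarrow> r X \<le> r Y"
    and rank_submodular: "X \<subseteq> S \<Longrightarrow> Y \<subseteq> S \<Longrightarrow> r (X \<union> Y) + r (X \<inter> Y) \<le> r X + r Y"

definition matroid_flats :: "'a set \<Rightarrow> ('a set \<Rightarrow> nat) \<Rightarrow> 'a set set" where
  "matroid_flats S r = {F. F \<subseteq> S \<and> (\<forall>x\<in>S - F. r F < r (insert x F))}"

text \<open>The groundspace is the whole type \<^typ>\<open>'b\<close>, as in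
  \<^locale>\<open>finite_dimensional_vector_space\<close>; the values of \<open>\<rho>\<close> on sets
  that are not subspaces are irrelevant. The sum of two subspaces is the elementwise
  sum \<open>+\<close> of sets. \<open>Basis\<close> serves only to express finite dimension.\<close>

locale q_matroid = finite_dimensional_vector_space scale Basis
  for scale :: "'k::{field,finite} \<Rightarrow> 'b::ab_group_add \<Rightarrow> 'b" and Basis :: "'b set" +
  fixes \<rho> :: "'b set \<Rightarrow> nat"
  assumes q_rank_le_dim: "subspace V \<Longrightarrow> \<rho> V \<le> dim V"
    and q_rank_mono: "subspace V \<Longrightarrow> subspace W \<Longrightarrow> V \<subseteq> W \<Longrightarrow> \<rho> V \<le> \<rho> W"
    and q_rank_submodular:
      "subspace V \<Longrightarrow> subspace W \<Longrightarrow> \<rho> (V + W) + \<rho> (V \<inter> W) \<le> \<rho> V + \<rho> W"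

definition q_flats ::
    "('k::{field,finite} \<Rightarrow> 'b::ab_group_add \<Rightarrow> 'b) \<Rightarrow> ('b set \<Rightarrow> nat) \<Rightarrow> 'b set set" where
  "q_flats scale \<rho> =
     {F. module.subspace scale F \<and> (\<forall>v. v \<notin> F \<longrightarrow> \<rho> F < \<rho> (F + module.span scale {v}))}"

definition proj_space :: "('k::{field,finite} \<Rightarrow> 'b::ab_group_add \<Rightarrow> 'b) \<Rightarrow> 'b set set" where
  "proj_space scale = {L. module.subspace scale L \<and> vector_space.dim scale L = 1}"

text \<open>The set $P^{-1}(F) \cup \{0\}$, for a set \<open>F\<close> of one-dimensional subspaces.\<close>

definition cone :: "'b::zero set set \<Rightarrow> 'b set" where
  "cone F = {0} \<union> \<Union>F"

definition inclusion_order :: "'a set set \<Rightarrow> 'a set gorder" where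
  "inclusion_order \<F> = \<lparr>carrier = \<F>, eq = (=), le = (\<subseteq>)\<rparr>"

definition lattice_isomorphic :: "'a gorder \<Rightarrow> 'b gorder \<Rightarrow> bool" where
  "lattice_isomorphic L L' \<longleftrightarrow>
     Lattice.lattice L \<and> Lattice.lattice L' \<and>
     (\<exists>\<phi>. bij_betw \<phi> (carrier L) (carrier L') \<and>
        (\<forall>x\<in>carrier L. \<forall>y\<in>carrier L.
           \<phi> (x \<sqinter>\<^bsub>L\<^esub> y) = \<phi> x \<sqinter>\<^bsub>L'\<^esub> \<phi> y \<and>
           \<phi> (x \<squnion>\<^bsub>L\<^esub> y) = \<phi> x \<squnion>\<^bsub>L'\<^esub> \<phi> y))"

end

theory Submission
  imports Defs
begin

text \<open>The rank function is \<open>\<rho> V = r (points_of V)\<close>, the rank of the projective points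
  lying in \<open>V\<close>. Every set \<open>X\<close> of points lies in a matroid flat of the same rank, and
  since the cone over that flat is a subspace, the flat contains all points in the linear span of
  \<open>X\<close>. So passing to linear spans never changes the rank; this reduces the axioms of a
  \<open>q\<close>-matroid for \<open>\<rho>\<close> and the description of its flats to properties of \<open>r\<close>.
  For uniqueness, adding one vector \<open>v\<close> to a subspace \<open>W\<close> raises the rank by at most
  one, and leaves it unchanged iff every flat above \<open>W\<close> contains \<open>v\<close>; the flats
  therefore determine the rank along a basis.\<close>

section \<open>Inclusion orders\<close>

lemma inclusion_order_simps [simp]:
  "carrier (inclusion_order \<F>) = \<F>"
  "x \<sqsubseteq>\<^bsub>inclusion_order \<F>\<^esub> y \<longleftrightarrow> x \<subseteq> y"
  "x .=\<^bsub>inclusion_order \<F>\<^esub> y \<longleftrightarrow> x = y"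
  by (simp_all add: inclusion_order_def)

lemma partial_order_inclusion_order: "partial_order (inclusion_order \<F>)"
  by unfold_locales (simp_all add: inclusion_order_def)

lemma least_Upper_inclusion_order:
  "least (inclusion_order \<F>) s (Upper (inclusion_order \<F>) A) \<longleftrightarrow>
     s \<in> \<F> \<and> (\<forall>a\<in>A \<inter> \<F>. a \<subseteq> s) \<and> (\<forall>u\<in>\<F>. (\<forall>a\<in>A \<inter> \<F>. a \<subseteq> u) \<longrightarrow> s \<subseteq> u)"
  by (simp add: least_def Upper_def) blast

lemma greatest_Lower_inclusion_order:
  "greatest (inclusion_order \<F>) s (Lower (inclusion_order \<F>) A) \<longleftrightarrow>
     s \<in> \<F> \<and> (\<forall>a\<in>A \<inter> \<F>. s \<subseteq> a) \<and> (\<forall>u\<in>\<F>. (\<forall>a\<in>A \<inter> \<F>. u \<subseteq> a) \<longrightarrow> u \<subseteq> s)"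
  by (simp add: greatest_def Lower_def) blast

text \<open>The join of two members is the intersection of all members above both; this family is
  nonempty because it contains \<open>S\<close>. The meet is the plain intersection.\<close>

lemma lattice_inclusion_order:
  assumes top: "S \<in> \<F>" "\<And>F. F \<in> \<F> \<Longrightarrow> F \<subseteq> S"
    and Inter: "\<And>\<G>. \<G> \<subseteq> \<F> \<Longrightarrow> \<G> \<noteq> {} \<Longrightarrow> \<Inter>\<G> \<in> \<F>"
  shows "Lattice.lattice (inclusion_order \<F>)"
proof -
  interpret partial_order "inclusion_order \<F>" by (rule partial_order_inclusion_order)
  show ?thesis
  proof unfold_locales
    fix x y assume "x \<in> carrier (inclusion_order \<F>)" "y \<in> carrier (inclusion_order \<F>)"
    then have xy: "x \<in> \<F>" "y \<in> \<F>" by simp_all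
    show "\<exists>s. least (inclusion_order \<F>) s (Upper (inclusion_order \<F>) {x, y})"
    proof
      have "\<Inter>{F \<in> \<F>. x \<subseteq> F \<and> y \<subseteq> F} \<in> \<F>"
        using top xy by (intro Inter) auto
      then show "least (inclusion_order \<F>) (\<Inter>{F \<in> \<F>. x \<subseteq> F \<and> y \<subseteq> F})
          (Upper (inclusion_order \<F>) {x, y})"
        using xy by (auto simp: least_Upper_inclusion_order)
    qed
    show "\<exists>s. greatest (inclusion_order \<F>) s (Lower (inclusion_order \<F>) {x, y})"
      using Inter[of "{x, y}"] xy
      by (intro exI[of _ "x \<inter> y"]) (auto simp: greatest_Lower_inclusion_order)
  qed
qed

text \<open>Joins and meets are determined by the order, so a bijection that preserves and reflects
  inclusion carries them over. The images of joins and meets also supply the bounds that make the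
  target a lattice.\<close>

lemma lattice_isomorphic_inclusion_order:
  assumes lat: "Lattice.lattice (inclusion_order \<A>)"
    and bij: "bij_betw \<phi> \<A> \<B>"
    and mono: "\<And>x y. x \<in> \<A> \<Longrightarrow> y \<in> \<A> \<Longrightarrow> \<phi> x \<subseteq> \<phi> y \<longleftrightarrow> x \<subseteq> y"
  shows "lattice_isomorphic (inclusion_order \<A>) (inclusion_order \<B>)"
proof -
  let ?A = "inclusion_order \<A>" and ?B = "inclusion_order \<B>"
  interpret A: Lattice.lattice ?A by (rule lat)
  interpret B: partial_order ?B by (rule partial_order_inclusion_order)
  have img: "\<B> = \<phi> ` \<A>" using bij by (simp add: bij_betw_def)
  have sup: "least ?B (\<phi> (x \<squnion>\<^bsub>?A\<^esub> y)) (Upper ?B {\<phi> x, \<phi> y})"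
    if "x \<in> \<A>" "y \<in> \<A>" for x y
  proof -
    have "least ?A (x \<squnion>\<^bsub>?A\<^esub> y) (Upper ?A {x, y})"
      using A.sup_of_two_least[of x y] that by (simp add: join_def)
    then show ?thesis
      using that by (auto simp: least_Upper_inclusion_order img mono)
  qed
  have inf: "greatest ?B (\<phi> (x \<sqinter>\<^bsub>?A\<^esub> y)) (Lower ?B {\<phi> x, \<phi> y})"
    if "x \<in> \<A>" "y \<in> \<A>" for x y
  proof -
    have "greatest ?A (x \<sqinter>\<^bsub>?A\<^esub> y) (Lower ?A {x, y})"
      using A.inf_of_two_greatest[of x y] that by (simp add: meet_def)
    then show ?thesis
      using that by (auto simp: greatest_Lower_inclusion_order img mono)
  qed
  interpret B: Lattice.lattice ?B
  proof unfold_locales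
    fix x y assume "x \<in> carrier ?B" "y \<in> carrier ?B"
    then obtain a b where "a \<in> \<A>" "b \<in> \<A>" "x = \<phi> a" "y = \<phi> b" by (auto simp: img)
    then show "\<exists>s. least ?B s (Upper ?B {x, y})" "\<exists>s. greatest ?B s (Lower ?B {x, y})"
      using sup inf by blast+
  qed
  have "\<phi> (x \<squnion>\<^bsub>?A\<^esub> y) = \<phi> x \<squnion>\<^bsub>?B\<^esub> \<phi> y" if "x \<in> \<A>" "y \<in> \<A>" for x y
    using B.least_unique[OF sup[OF that] B.sup_of_two_least[of "\<phi> x" "\<phi> y"]] that
    by (simp add: join_def img)
  moreover have "\<phi> (x \<sqinter>\<^bsub>?A\<^esub> y) = \<phi> x \<sqinter>\<^bsub>?B\<^esub> \<phi> y" if "x \<in> \<A>" "y \<in> \<A>" for x y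
    using B.greatest_unique[OF inf[OF that] B.inf_of_two_greatest[of "\<phi> x" "\<phi> y"]] that
    by (simp add: meet_def img)
  ultimately show ?thesis
    unfolding lattice_isomorphic_def
    using lat B.lattice_axioms bij by (auto intro!: exI[of _ \<phi>])
qed

section \<open>Flats of matroids\<close>

context matroid
begin

lemma flat_subset: "F \<in> matroid_flats S r \<Longrightarrow> F \<subseteq> S"
  by (simp add: matroid_flats_def)

lemma ground_flat: "S \<in> matroid_flats S r"
  by (simp add: matroid_flats_def)

text \<open>A maximal superset of \<open>X\<close> with the same rank is a flat: a point whose
  insertion kept the rank would contradict maximality.\<close>

lemma exists_flat_same_rank:
  assumes "X \<subseteq> S"
  obtains F where "F \<in> matroid_flats S r" "X \<subseteq> F" "r F = r X"
proof -
  let ?C = "{F. X \<subseteq> F \<and> F \<subseteq> S \<and> r F = r X}"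
  have fin: "finite ?C" by (rule finite_subset[of _ "Pow S"]) (use finite_ground in auto)
  have "X \<in> ?C" using assms by simp
  from finite_has_maximal2[OF fin this] obtain F
    where F: "F \<in> ?C" and max: "\<And>G. G \<in> ?C \<Longrightarrow> F \<subseteq> G \<Longrightarrow> F = G"
    by meson
  have "r F < r (insert x F)" if x: "x \<in> S - F" for x
  proof (rule ccontr)
    assume "\<not> ?thesis"
    moreover have "r F \<le> r (insert x F)" using F x by (intro rank_mono) auto
    ultimately have "insert x F \<in> ?C" using F x by auto
    then show False using max x by blast
  qed
  then show thesis using F that[of F] by (auto simp: matroid_flats_def)
qed

lemma flats_Inter:
  assumes "\<G> \<subseteq> matroid_flats S r" "\<G> \<noteq> {}"
  shows "\<Inter>\<G> \<in> matroid_flats S r"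
proof -
  have sub: "\<Inter>\<G> \<subseteq> S" using assms flat_subset by blast
  moreover have "r (\<Inter>\<G>) < r (insert x (\<Inter>\<G>))" if x: "x \<in> S - \<Inter>\<G>" for x
  proof -
    obtain G where G: "G \<in> \<G>" "x \<notin> G" using x by blast
    then have GS: "G \<subseteq> S" and lt: "r G < r (insert x G)"
      using assms x by (auto simp: matroid_flats_def)
    \<comment> \<open>With these identities, submodularity transfers the strict gain of
      \<open>x\<close> over \<open>G\<close> down to the intersection.\<close>
    have "insert x (\<Inter>\<G>) \<union> G = insert x G" "insert x (\<Inter>\<G>) \<inter> G = \<Inter>\<G>" using G by auto
    then show ?thesis
      using rank_submodular[of "insert x (\<Inter>\<G>)" G] lt GS x sub by auto
  qed
  ultimately show ?thesis by (simp add: matroid_flats_def)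
qed

lemma lattice_flats: "Lattice.lattice (inclusion_order (matroid_flats S r))"
  by (rule lattice_inclusion_order[of S]) (auto intro: ground_flat flats_Inter dest: flat_subset)

end

section \<open>Uniqueness of a q-matroid with given flats\<close>

context vector_space
begin

lemma set_plus_eq_span_Un:
  assumes "subspace V" "subspace W"
  shows "V + W = span (V \<union> W)"
proof -
  have "span V = V" "span W = W" using assms by simp_all
  then show ?thesis unfolding span_Un set_plus_def by (simp only:) blast
qed

lemma set_plus_span_singleton:
  assumes "subspace V"
  shows "V + span {v} = span (insert v V)"
proof -
  have "V + span {v} = span (V \<union> span {v})" using assms by (simp add: set_plus_eq_span_Un)
  also have "\<dots> = span (V \<union> {v})" by (simp only: span_Un span_span)
  finally show ?thesis by simp
qed

end

context q_matroid
begin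

text \<open>Submodularity against the span of \<open>v\<close>, whose rank is bounded by its
  dimension and hence by one.\<close>

lemma rank_span_insert_le:
  assumes V: "subspace V"
  shows "\<rho> (span (insert v V)) \<le> \<rho> V + 1"
proof -
  have "\<rho> (span (insert v V)) \<le> \<rho> V + \<rho> (span {v})"
    using q_rank_submodular[OF V subspace_span[of "{v}"]]
    by (simp add: set_plus_span_singleton[OF V])
  moreover have "\<rho> (span {v}) \<le> dim (span {v})" by (rule q_rank_le_dim) simp
  moreover have "dim (span {v}) \<le> 1" using dim_le_card'[of "{v}"] by simp
  ultimately show ?thesis by linarith
qed

lemma q_flats_iff:
  "F \<in> q_flats scale \<rho> \<longleftrightarrow> subspace F \<and> (\<forall>v. v \<notin> F \<longrightarrow> \<rho> F < \<rho> (span (insert v F)))"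
  by (auto simp: q_flats_def set_plus_span_singleton)

lemma exists_q_flat_same_rank:
  assumes V: "subspace V"
  obtains F where "F \<in> q_flats scale \<rho>" "V \<subseteq> F" "\<rho> F = \<rho> V"
proof -
  let ?C = "\<lambda>F. subspace F \<and> V \<subseteq> F \<and> \<rho> F = \<rho> V"
  \<comment> \<open>Dimensions are bounded, so a subspace of largest dimension exists among those
    above \<open>V\<close> with the rank of \<open>V\<close>; it takes the place of the
    inclusion-maximal set in the matroid case.\<close>
  obtain F where F: "?C F" and max: "\<And>G. ?C G \<Longrightarrow> dim G \<le> dim F"
    using ex_has_greatest_nat[of ?C V dim "Suc dimension"] V dim_subset_UNIV
    by (metis le_imp_less_Suc order_refl)
  have "\<rho> F < \<rho> (span (insert v F))" if v: "v \<notin> F" for v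
  proof (rule ccontr)
    assume "\<not> ?thesis"
    moreover have FF: "F \<subseteq> span (insert v F)" using span_superset[of "insert v F"] by simp
    moreover have "\<rho> F \<le> \<rho> (span (insert v F))"
      using F FF by (intro q_rank_mono) auto
    ultimately have "?C (span (insert v F))" using F by auto
    then have "dim (insert v F) \<le> dim F" using max[of "span (insert v F)"] by simp
    moreover have "span F = F" using F by simp
    then have "v \<notin> span F" using v by (simp only:) simp
    ultimately show False by (simp add: dim_insert)
  qed
  then show thesis using F that[of F] by (simp add: q_flats_iff)
qed

text \<open>The right-hand side mentions the rank function only through its flats, so two q-matroids
  with the same flats agree on which extensions by one vector raise the rank.\<close>

lemma rank_span_insert_eq_iff:
  assumes V: "subspace V"
  shows "\<rho> (span (insert v V)) = \<rho> V \<longleftrightarrow> (\<forall>F\<in>q_flats scale \<rho>. V \<subseteq> F \<longrightarrow> v \<in> F)"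
proof
  let ?W = "span (insert v V)"
  have VW: "V \<subseteq> ?W" and vW: "v \<in> ?W" using span_superset[of "insert v V"] by auto
  show "\<forall>F\<in>q_flats scale \<rho>. V \<subseteq> F \<longrightarrow> v \<in> F" if eq: "\<rho> ?W = \<rho> V"
  proof (intro ballI impI, rule ccontr)
    fix F assume F: "F \<in> q_flats scale \<rho>" and VF: "V \<subseteq> F" and v: "v \<notin> F"
    have sF: "subspace F" and lt: "\<rho> F < \<rho> (span (insert v F))" using F v by (auto simp: q_flats_iff)
    \<comment> \<open>Submodularity for \<open>F\<close> and \<open>?W\<close>: their intersection
      contains \<open>V\<close> and so has rank at least that of \<open>?W\<close>. Hence
      \<open>F + ?W\<close>, which contains \<open>v\<close>, has rank at most that of
      \<open>F\<close>, contrary to \<open>F\<close> being a flat.\<close>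
    have "\<rho> (span (insert v F)) \<le> \<rho> (F + ?W)"
      using sF vW
      by (intro q_rank_mono span_mono subspace_span)
         (auto simp: set_plus_eq_span_Un intro!: span_mono)
    moreover have "\<rho> V \<le> \<rho> (F \<inter> ?W)"
      using V sF VF VW by (intro q_rank_mono subspace_inter) auto
    moreover have "\<rho> (F + ?W) + \<rho> (F \<inter> ?W) \<le> \<rho> F + \<rho> ?W"
      using sF by (intro q_rank_submodular) auto
    ultimately show False using eq lt by linarith
  qed
  show "\<rho> ?W = \<rho> V" if all: "\<forall>F\<in>q_flats scale \<rho>. V \<subseteq> F \<longrightarrow> v \<in> F"
  proof -
    \<comment> \<open>A flat above \<open>V\<close> of equal rank contains \<open>v\<close> by
      assumption, hence all of \<open>?W\<close>, which bounds the rank of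
      \<open>?W\<close>.\<close>
    obtain F where F: "F \<in> q_flats scale \<rho>" "V \<subseteq> F" "\<rho> F = \<rho> V"
      using exists_q_flat_same_rank[OF V] .
    then have sF: "subspace F" by (simp add: q_flats_iff)
    have "?W \<subseteq> F" using F all sF by (intro span_minimal) auto
    then have "\<rho> ?W \<le> \<rho> V" using F sF q_rank_mono[of ?W F] by simp
    moreover have "\<rho> V \<le> \<rho> ?W" using V VW by (intro q_rank_mono) auto
    ultimately show ?thesis by simp
  qed
qed

end

lemma q_matroid_rank_unique:
  assumes "q_matroid scale Basis \<rho>" "q_matroid scale Basis \<rho>'"
    and flats: "q_flats scale \<rho> = q_flats scale \<rho>'"
    and V: "module.subspace scale V"
  shows "\<rho> V = \<rho>' V"
proof -
  interpret A: q_matroid scale Basis \<rho> by fact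
  interpret B: q_matroid scale Basis \<rho>' by fact
  have *: "\<rho> (A.span X) = \<rho>' (A.span X)" if "finite X" for X
    using that
  proof (induction X rule: finite_induct)
    case empty
    \<comment> \<open>Both ranks vanish on the zero subspace, which starts the comparison along a
      basis.\<close>
    have "A.dim {0} = 0" by (simp add: A.dim_eq_0)
    then show ?case using A.q_rank_le_dim[of "{0}"] B.q_rank_le_dim[of "{0}"] by simp
  next
    case (insert x X)
    let ?W = "A.span X" and ?W' = "A.span (insert x X)"
    have W': "A.span (insert x ?W) = ?W'"
      using A.span_Un[of ?W "{x}"] A.span_Un[of X "{x}"]
      by (simp only: A.span_span Un_insert_right Un_empty_right)
    have "?W \<subseteq> ?W'" by (intro A.span_mono) auto
    then have "\<rho> ?W \<le> \<rho> ?W'" "\<rho>' ?W \<le> \<rho>' ?W'"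
      by (auto intro: A.q_rank_mono B.q_rank_mono)
    moreover have "\<rho> ?W' \<le> \<rho> ?W + 1" "\<rho>' ?W' \<le> \<rho>' ?W + 1"
      using A.rank_span_insert_le[of ?W x] B.rank_span_insert_le[of ?W x] by (simp_all add: W')
    moreover have "\<rho> ?W' = \<rho> ?W \<longleftrightarrow> \<rho>' ?W' = \<rho>' ?W"
      using A.rank_span_insert_eq_iff[of ?W x] B.rank_span_insert_eq_iff[of ?W x] flats
      by (simp add: W')
    \<comment> \<open>Each rank grows by zero or one, and one stays constant exactly when the other
      does, so the increments agree.\<close>
    ultimately show ?case using insert.IH by linarith
  qed
  obtain X where X: "X \<subseteq> V" "A.independent X" "V \<subseteq> A.span X"
    by (rule A.basis_exists)
  have "finite X" using X by (simp add: A.finiteI_independent)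
  moreover have "A.span X = V" using X V by (intro A.span_subspace)
  ultimately show ?thesis using *[of X] by simp
qed

section \<open>The q-matroid of a matroid whose flats are cones\<close>

text \<open>The map back from subspaces to sets of projective points: \<open>cone_points\<close> and
  \<open>points_cone\<close> show that it inverts \<open>cone\<close> on subspaces and on sets of
  points whose cone is a subspace.\<close>

definition points_of ::
    "('k::{field,finite} \<Rightarrow> 'b::ab_group_add \<Rightarrow> 'b) \<Rightarrow> 'b set \<Rightarrow> 'b set set" where
  "points_of scale V = {L \<in> proj_space scale. L \<subseteq> V}"

locale cone_matroid = finite_dimensional_vector_space scale Basis + matroid "proj_space scale" r
  for scale :: "'k::{field,finite} \<Rightarrow> 'b::ab_group_add \<Rightarrow> 'b" and Basis :: "'b set"
    and r :: "'b set set \<Rightarrow> nat" +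
  assumes subspace_cone: "F \<in> matroid_flats (proj_space scale) r \<Longrightarrow> subspace (cone F)"
begin

abbreviation "points \<equiv> points_of scale"
abbreviation "flats \<equiv> matroid_flats (proj_space scale) r"

section \<open>Projective points and the cones over them\<close>

lemma span_in_proj_space: "v \<noteq> 0 \<Longrightarrow> span {v} \<in> proj_space scale"
  by (simp add: proj_space_def)

lemma proj_space_eq_span:
  assumes "L \<in> proj_space scale" "v \<in> L" "v \<noteq> 0"
  shows "L = span {v}"
proof (rule sym, rule subspace_dim_equal)
  show "span {v} \<subseteq> L" using assms by (intro span_minimal) (auto simp: proj_space_def)
qed (use assms in \<open>auto simp: proj_space_def\<close>)

lemma proj_space_nonzero:
  assumes "L \<in> proj_space scale"
  obtains v where "v \<in> L" "v \<noteq> 0"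
proof -
  have "\<not> L \<subseteq> {0}" using assms by (auto simp: proj_space_def dim_eq_0[symmetric])
  then show thesis using that by blast
qed

lemma points_subset: "points V \<subseteq> proj_space scale"
  by (auto simp: points_of_def)

lemma points_mono: "V \<subseteq> W \<Longrightarrow> points V \<subseteq> points W"
  by (auto simp: points_of_def)

lemma points_Int: "points (V \<inter> W) = points V \<inter> points W"
  by (auto simp: points_of_def)

lemma span_in_points: "subspace V \<Longrightarrow> v \<in> V \<Longrightarrow> v \<noteq> 0 \<Longrightarrow> span {v} \<in> points V"
  by (simp add: points_of_def span_in_proj_space span_minimal)

lemma cone_points:
  assumes V: "subspace V"
  shows "cone (points V) = V"
proof
  show "cone (points V) \<subseteq> V"
    using subspace_0[OF V] by (auto simp: cone_def points_of_def)
  show "V \<subseteq> cone (points V)"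
  proof
    fix v assume "v \<in> V"
    then show "v \<in> cone (points V)"
      using span_in_points[OF V] span_base[of v "{v}"] by (cases "v = 0") (auto simp: cone_def)
  qed
qed

text \<open>Any nonzero vector of a projective point determines it, so a point inside the cone must
  coincide with the member of \<open>F\<close> that contains such a vector.\<close>

lemma points_cone:
  assumes "F \<subseteq> proj_space scale"
  shows "points (cone F) = F"
proof
  show "F \<subseteq> points (cone F)" using assms by (auto simp: points_of_def cone_def)
  show "points (cone F) \<subseteq> F"
  proof
    fix L assume L: "L \<in> points (cone F)"
    then obtain v where v: "v \<in> L" "v \<noteq> 0"
      using points_subset by (blast elim: proj_space_nonzero)
    then obtain L' where "L' \<in> F" "v \<in> L'" using L by (auto simp: points_of_def cone_def)
    then have "L' = L"
      using v L assms points_subset proj_space_eq_span[of L' v] proj_space_eq_span[of L v] by blast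
    then show "L \<in> F" using \<open>L' \<in> F\<close> by simp
  qed
qed

lemma cone_mono_iff:
  assumes "F \<subseteq> proj_space scale" "G \<subseteq> proj_space scale"
  shows "cone F \<subseteq> cone G \<longleftrightarrow> F \<subseteq> G"
proof
  show "F \<subseteq> G" if "cone F \<subseteq> cone G" using points_mono[OF that] assms by (simp add: points_cone)
  show "cone F \<subseteq> cone G" if "F \<subseteq> G" using that by (auto simp: cone_def)
qed

text \<open>Here the assumption on cones enters the rank axioms: the cone over a flat above
  \<open>X\<close> of equal rank is a subspace, so it absorbs the span, and the rank in question
  lies between \<open>r X\<close> and the rank of that flat.\<close>

lemma rank_points_span_cone:
  assumes "X \<subseteq> proj_space scale"
  shows "r (points (span (cone X))) = r X"
proof (rule antisym)
  obtain F where F: "F \<in> flats" "X \<subseteq> F" "r F = r X"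
    using exists_flat_same_rank[OF assms] .
  have "cone X \<subseteq> cone F" using F(2) by (auto simp: cone_def)
  then have "span (cone X) \<subseteq> cone F" using F by (intro span_minimal subspace_cone) auto
  then have "points (span (cone X)) \<subseteq> F"
    using points_mono points_cone[OF flat_subset[OF F(1)]] by blast
  then show "r (points (span (cone X))) \<le> r X"
    using rank_mono flat_subset F by metis
  have "X \<subseteq> points (span (cone X))"
    using points_mono[OF span_superset] points_cone[OF assms] by blast
  then show "r X \<le> r (points (span (cone X)))" by (intro rank_mono points_subset)
qed

text \<open>The lines through the vectors of a basis have a cone that spans \<open>V\<close>, and
  there are at most \<open>dim V\<close> of them.\<close>

lemma rank_points_le_dim:
  assumes V: "subspace V"
  shows "r (points V) \<le> dim V"
proof -
  obtain B where B: "B \<subseteq> V" "independent B" "V \<subseteq> span B" "card B = dim V"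
    using basis_exists .
  let ?X = "(\<lambda>b. span {b}) ` B"
  have fB: "finite B" using B by (simp add: finiteI_independent)
  \<comment> \<open>Every basis vector must be nonzero for its span to be a projective
    point.\<close>
  have "0 \<notin> B" using B dependent_zero by blast
  then have X: "?X \<subseteq> proj_space scale" by (metis span_in_proj_space image_subsetI)
  have "B \<subseteq> cone ?X" by (auto simp: cone_def intro: span_base)
  then have "V \<subseteq> span (cone ?X)" using B span_mono by blast
  then have "r (points V) \<le> r (points (span (cone ?X)))"
    by (intro rank_mono points_mono points_subset)
  also have "\<dots> = r ?X" by (rule rank_points_span_cone[OF X])
  also have "\<dots> \<le> card ?X" by (rule rank_le_card[OF X])
  also have "\<dots> \<le> dim V" using card_image_le[OF fB] B by metis
  finally show ?thesis .
qed

text \<open>The cone over the union of the two point sets is \<open>V \<union> W\<close>, whose span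
  is the sum. This turns submodularity of \<open>r\<close> into submodularity on subspaces.\<close>

lemma rank_points_set_plus:
  assumes V: "subspace V" and W: "subspace W"
  shows "r (points (V + W)) = r (points V \<union> points W)"
proof -
  have "cone (points V \<union> points W) = V \<union> W"
    using cone_points[OF V] cone_points[OF W] by (auto simp: cone_def)
  then show ?thesis
    using rank_points_span_cone[of "points V \<union> points W"] points_subset
    by (simp add: set_plus_eq_span_Un[OF V W])
qed

section \<open>The rank axioms and the flats of the induced q-matroid\<close>

lemma q_matroid_rank_points: "q_matroid scale Basis (\<lambda>V. r (points V))"
proof unfold_locales
  fix V W assume VW: "subspace V" "subspace W"
  show "r (points (V + W)) + r (points (V \<inter> W)) \<le> r (points V) + r (points W)"
    unfolding rank_points_set_plus[OF VW] points_Int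
    by (intro rank_submodular points_subset)
qed (intro rank_points_le_dim rank_mono points_mono points_subset; assumption)+

text \<open>Adding a vector \<open>v\<close> outside \<open>V\<close> matches inserting the point
  \<open>span {v}\<close> outside \<open>points V\<close>; by \<open>rank_points_set_plus\<close>
  the rank increases for the one exactly when it does for the other.\<close>

lemma q_flats_rank_points: "q_flats scale (\<lambda>V. r (points V)) = {cone F |F. F \<in> flats}"
proof (intro subset_antisym subsetI)
  fix V assume "V \<in> q_flats scale (\<lambda>V. r (points V))"
  then have V: "subspace V"
    and lt: "\<And>v. v \<notin> V \<Longrightarrow> r (points V) < r (points (V + span {v}))"
    by (auto simp: q_flats_def)
  have "points V \<in> flats"
    unfolding matroid_flats_def
  proof (intro CollectI conjI ballI points_subset)
    fix L assume L: "L \<in> proj_space scale - points V"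
    then obtain v where v: "v \<in> L" "v \<noteq> 0" by (blast elim: proj_space_nonzero)
    then have Lv: "L = span {v}" using L proj_space_eq_span by blast
    then have "v \<notin> V" using L v span_in_points[OF V] by auto
    \<comment> \<open>The cone over the single point \<open>L\<close> is \<open>L\<close> itself, so
      \<open>points_cone\<close> applies.\<close>
    moreover have "points L = {L}"
      using points_cone[of "{L}"] L subspace_0 Lv by (simp add: cone_def insert_absorb)
    ultimately show "r (points V) < r (insert L (points V))"
      using lt[of v] rank_points_set_plus[OF V, of L] Lv by simp
  qed
  then show "V \<in> {cone F |F. F \<in> flats}" using cone_points[OF V] by blast
next
  fix V assume "V \<in> {cone F |F. F \<in> flats}"
  then obtain F where F: "F \<in> flats" and VF: "V = cone F" by blast
  have V: "subspace V" using F VF subspace_cone by simp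
  have pV: "points V = F" using F VF points_cone flat_subset by simp
  have "r (points V) < r (points (V + span {v}))" if v: "v \<notin> V" for v
  proof -
    have "v \<noteq> 0" using v V subspace_0 by blast
    then have L: "span {v} \<in> proj_space scale" by (rule span_in_proj_space)
    moreover have "span {v} \<notin> F"
      using v VF span_base[of v "{v}"] by (auto simp: cone_def)
    ultimately have "r F < r (insert (span {v}) F)" using F by (simp add: matroid_flats_def)
    also have "\<dots> \<le> r (points V \<union> points (span {v}))"
    proof (rule rank_mono)
      have "span {v} \<in> points (span {v})" using L by (simp add: points_of_def)
      then show "insert (span {v}) F \<subseteq> points V \<union> points (span {v})" by (auto simp: pV)
    qed (simp add: points_subset)
    also have "\<dots> = r (points (V + span {v}))"
      by (simp add: rank_points_set_plus V)
    finally show ?thesis by (simp add: pV)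
  qed
  then show "V \<in> q_flats scale (\<lambda>V. r (points V))" using V by (simp add: q_flats_def)
qed

lemma lattice_isomorphic_cones:
  "lattice_isomorphic (inclusion_order flats) (inclusion_order {cone F |F. F \<in> flats})"
proof (rule lattice_isomorphic_inclusion_order[OF lattice_flats])
  have "inj_on cone flats"
    by (rule inj_on_inverseI[of _ points]) (simp add: points_cone flat_subset)
  then show "bij_betw cone flats {cone F |F. F \<in> flats}" by (auto simp: bij_betw_def)
qed (simp add: cone_mono_iff flat_subset)

end

theorem theorem3p3:
  fixes scale :: "'k::{field,finite} \<Rightarrow> 'b::ab_group_add \<Rightarrow> 'b"
    and Basis :: "'b set"
    and r :: "'b set set \<Rightarrow> nat"
  assumes "finite_dimensional_vector_space scale Basis"
    and "matroid (proj_space scale) r"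
    and "\<And>F. F \<in> matroid_flats (proj_space scale) r \<Longrightarrow> module.subspace scale (cone F)"
  shows "\<exists>\<rho>. q_matroid scale Basis \<rho> \<and>
    q_flats scale \<rho> = {cone F |F. F \<in> matroid_flats (proj_space scale) r} \<and>
    (\<forall>\<rho>'. q_matroid scale Basis \<rho>' \<and>
        q_flats scale \<rho>' = {cone F |F. F \<in> matroid_flats (proj_space scale) r} \<longrightarrow>
        (\<forall>V. module.subspace scale V \<longrightarrow> \<rho>' V = \<rho> V)) \<and>
    lattice_isomorphic
      (inclusion_order (matroid_flats (proj_space scale) r))
      (inclusion_order (q_flats scale \<rho>))"
proof -
  interpret cone_matroid scale Basis r
    using assms by (simp add: cone_matroid_def cone_matroid_axioms_def)
  show ?thesis
  proof (intro exI[of _ "\<lambda>V. r (points V)"] conjI allI impI)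
    show "\<rho>' V = r (points V)"
      if "q_matroid scale Basis \<rho>' \<and> q_flats scale \<rho>' = {cone F |F. F \<in> flats}" "subspace V"
      for \<rho>' V
      using q_matroid_rank_unique[OF _ q_matroid_rank_points] q_flats_rank_points that by metis
  qed (simp_all add: q_matroid_rank_points q_flats_rank_points lattice_isomorphic_cones)
qed

end
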